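(* Let $m\geq2$, let $k_2,\dots,k_m\geq 2$ be integers, let $P(z)\in\mathbb{K}[z]$ be a polynomial of degree $d\geq 2$, and let $Y=\{y_1y_2^{k_2}\cdots y_m^{k_m}=P(z)\}\subset\mathbb{K}^{m+1}$. Then $\mathrm{Aut}(Y)$ is not commutative.
   Context: $\mathbb{K}$ is an algebraically closed field of characteristic zero. $\mathrm{Aut}(Y)$ is the group of automorphisms of the affine variety $Y$. *)

theory Defs
  imports
    "HOL-Computational_Algebra.Polynomial"
    "HOL-Library.FuncSet"
    "HOL-Algebra.Bij"
begin

text \<open>
  Points of affine $n$-space are indexed by $1, \dots, n$; extensionality makes equality of
  points the same as equality of these $n$ coordinates.
\<close>

definition affine_space :: "nat \<Rightarrow> (nat \<Rightarrow> 'a) set" where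
  "affine_space n = {1..n} \<rightarrow>\<^sub>E UNIV"

inductive_set polynomial_functions :: "nat \<Rightarrow> ((nat \<Rightarrow> 'a::comm_ring_1) \<Rightarrow> 'a) set"
  for n :: nat
where
  const: "(\<lambda>x. c) \<in> polynomial_functions n"
| coord: "i \<in> {1..n} \<Longrightarrow> (\<lambda>x. x i) \<in> polynomial_functions n"
| add: "p \<in> polynomial_functions n \<Longrightarrow> q \<in> polynomial_functions n
    \<Longrightarrow> (\<lambda>x. p x + q x) \<in> polynomial_functions n"
| mult: "p \<in> polynomial_functions n \<Longrightarrow> q \<in> polynomial_functions n
    \<Longrightarrow> (\<lambda>x. p x * q x) \<in> polynomial_functions n"

text \<open>
  The regular functions on a closed subset of affine space are exactly the restrictions of
  polynomials, and the morphisms between closed subsets are the maps with regular components.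
  The two definitions below are meant to be used for closed \<open>X\<close> and \<open>Y\<close> only.
\<close>

definition regular_function :: "nat \<Rightarrow> (nat \<Rightarrow> 'a::comm_ring_1) set \<Rightarrow> ((nat \<Rightarrow> 'a) \<Rightarrow> 'a) \<Rightarrow> bool"
  where "regular_function n X g \<longleftrightarrow> (\<exists>p \<in> polynomial_functions n. \<forall>x\<in>X. g x = p x)"

definition regular_map ::
    "nat \<Rightarrow> (nat \<Rightarrow> 'a::comm_ring_1) set \<Rightarrow> nat \<Rightarrow> (nat \<Rightarrow> 'a) set
      \<Rightarrow> ((nat \<Rightarrow> 'a) \<Rightarrow> (nat \<Rightarrow> 'a)) \<Rightarrow> bool"
  where "regular_map n X l Y f \<longleftrightarrow>
    f \<in> X \<rightarrow> Y \<and> (\<forall>i\<in>{1..l}. regular_function n X (\<lambda>x. f x i))"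

definition variety_automorphisms ::
    "nat \<Rightarrow> (nat \<Rightarrow> 'a::comm_ring_1) set \<Rightarrow> ((nat \<Rightarrow> 'a) \<Rightarrow> (nat \<Rightarrow> 'a)) set"
  where "variety_automorphisms n Y =
    {f \<in> Bij Y. regular_map n Y n Y f \<and> regular_map n Y n Y (restrict (inv_into Y f) Y)}"

definition variety_Aut ::
    "nat \<Rightarrow> (nat \<Rightarrow> 'a::comm_ring_1) set \<Rightarrow> ((nat \<Rightarrow> 'a) \<Rightarrow> (nat \<Rightarrow> 'a)) monoid"
  where "variety_Aut n Y = BijGroup Y \<lparr>carrier := variety_automorphisms n Y\<rparr>"

text \<open>The coordinate \<open>z\<close> is the last one, with index \<open>m + 1\<close>.\<close>

definition Y_variety ::
    "nat \<Rightarrow> (nat \<Rightarrow> nat) \<Rightarrow> 'a::comm_ring_1 poly \<Rightarrow> (nat \<Rightarrow> 'a) set"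
  where "Y_variety m k P =
    {y \<in> affine_space (m + 1). y 1 * (\<Prod>i=2..m. y i ^ k i) = poly P (y (m + 1))}"

lemma regular_function_compose:
  assumes f: "regular_map n X l Y f" and g: "regular_function l Y g"
  shows "regular_function n X (\<lambda>x. g (f x))"
proof -
  obtain p where p: "p \<in> polynomial_functions l" "\<forall>y\<in>Y. g y = p y"
    using g by (auto simp: regular_function_def)
  have fY: "f x \<in> Y" if "x \<in> X" for x
    using f that by (auto simp: regular_map_def)
  from p(1) have "\<exists>q \<in> polynomial_functions n. \<forall>x\<in>X. p (f x) = q x"
  proof induction
    case (const c)
    show ?case by (rule bexI[OF _ polynomial_functions.const[of c]]) simp
  next
    case (coord i)
    then show ?case using f by (simp add: regular_map_def regular_function_def)
  next
    case (add p q)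
    then obtain p' q' where "p' \<in> polynomial_functions n" "\<forall>x\<in>X. p (f x) = p' x"
      "q' \<in> polynomial_functions n" "\<forall>x\<in>X. q (f x) = q' x" by blast
    then show ?case
      by (intro bexI[OF _ polynomial_functions.add[of p' n q']]) auto
  next
    case (mult p q)
    then obtain p' q' where "p' \<in> polynomial_functions n" "\<forall>x\<in>X. p (f x) = p' x"
      "q' \<in> polynomial_functions n" "\<forall>x\<in>X. q (f x) = q' x" by blast
    then show ?case
      by (intro bexI[OF _ polynomial_functions.mult[of p' n q']]) auto
  qed
  then show ?thesis using p(2) fY by (simp add: regular_function_def)
qed

lemma regular_function_cong:
  "(\<And>x. x \<in> X \<Longrightarrow> g x = h x) \<Longrightarrow> regular_function n X g \<longleftrightarrow> regular_function n X h"
  by (simp add: regular_function_def)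

lemma regular_map_compose:
  assumes "regular_map n X l Y f" "regular_map l Y r Z g"
  shows "regular_map n X r Z (compose X g f)"
  unfolding regular_map_def
proof (intro conjI ballI)
  show "compose X g f \<in> X \<rightarrow> Z"
    using assms by (auto simp: regular_map_def compose_def)
next
  fix i assume "i \<in> {1..r}"
  then have "regular_function n X (\<lambda>x. g (f x) i)"
    using regular_function_compose[OF assms(1), of "\<lambda>y. g y i"] assms(2)
    by (simp add: regular_map_def)
  then show "regular_function n X (\<lambda>x. compose X g f x i)"
    by (subst regular_function_cong[where h = "\<lambda>x. g (f x) i"]) (simp_all add: compose_eq)
qed

lemma regular_map_id: "regular_map n X n X (\<lambda>x\<in>X. x)"
  unfolding regular_map_def regular_function_def
proof (intro conjI ballI)
  fix i assume "i \<in> {1..n}"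
  then show "\<exists>p\<in>polynomial_functions n. \<forall>x\<in>X. (\<lambda>x\<in>X. x) x i = p x"
    by (intro bexI[OF _ polynomial_functions.coord]) auto
qed simp

lemma subgroup_variety_automorphisms: "subgroup (variety_automorphisms n Y) (BijGroup Y)"
proof -
  interpret B: group "BijGroup Y" by (rule group_BijGroup)
  have memD: "f \<in> Bij Y" "regular_map n Y n Y f" "regular_map n Y n Y (inv\<^bsub>BijGroup Y\<^esub> f)"
    if "f \<in> variety_automorphisms n Y" for f
    using that by (auto simp: variety_automorphisms_def inv_BijGroup)
  have memI: "f \<in> variety_automorphisms n Y"
    if "f \<in> Bij Y" "regular_map n Y n Y f" "regular_map n Y n Y (inv\<^bsub>BijGroup Y\<^esub> f)" for f
    using that by (auto simp: variety_automorphisms_def inv_BijGroup)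
  have car: "carrier (BijGroup Y) = Bij Y" by (simp add: BijGroup_def)
  have mul: "f \<otimes>\<^bsub>BijGroup Y\<^esub> g = compose Y f g" if "f \<in> Bij Y" "g \<in> Bij Y" for f g
    using that by (simp add: BijGroup_def)
  have one: "\<one>\<^bsub>BijGroup Y\<^esub> = (\<lambda>x\<in>Y. x)" by (simp add: BijGroup_def)
  show ?thesis
  proof
    show "variety_automorphisms n Y \<subseteq> carrier (BijGroup Y)"
      using memD(1) car by blast
    show "\<one>\<^bsub>BijGroup Y\<^esub> \<in> variety_automorphisms n Y"
      by (rule memI) (simp_all only: B.inv_one, simp_all add: one id_Bij regular_map_id)
  next
    fix f assume f: "f \<in> variety_automorphisms n Y"
    then show "inv\<^bsub>BijGroup Y\<^esub> f \<in> variety_automorphisms n Y"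
      using memD[OF f] B.inv_closed[of f] B.inv_inv[of f] by (intro memI) (simp_all add: car)
  next
    fix f g assume f: "f \<in> variety_automorphisms n Y" and g: "g \<in> variety_automorphisms n Y"
    have c: "f \<in> carrier (BijGroup Y)" "g \<in> carrier (BijGroup Y)"
      using memD(1)[OF f] memD(1)[OF g] by (simp_all add: car)
    have i: "inv\<^bsub>BijGroup Y\<^esub> f \<in> Bij Y" "inv\<^bsub>BijGroup Y\<^esub> g \<in> Bij Y"
      using B.inv_closed c car by auto
    show "f \<otimes>\<^bsub>BijGroup Y\<^esub> g \<in> variety_automorphisms n Y"
    proof (rule memI)
      show "f \<otimes>\<^bsub>BijGroup Y\<^esub> g \<in> Bij Y"
        using B.m_closed[OF c] by (simp add: car)
      show "regular_map n Y n Y (f \<otimes>\<^bsub>BijGroup Y\<^esub> g)"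
        using regular_map_compose[OF memD(2)[OF g] memD(2)[OF f]]
        by (simp add: mul memD(1)[OF f] memD(1)[OF g])
      show "regular_map n Y n Y (inv\<^bsub>BijGroup Y\<^esub> (f \<otimes>\<^bsub>BijGroup Y\<^esub> g))"
        using regular_map_compose[OF memD(3)[OF f] memD(3)[OF g]]
        by (simp add: B.inv_mult_group[OF c] mul i)
    qed
  qed
qed

text \<open>
  Hence \<open>\<not> comm_group (variety_Aut n Y)\<close> can only hold because multiplication in
  \<open>variety_Aut n Y\<close> is not commutative.
\<close>

lemma group_variety_Aut: "group (variety_Aut n Y)"
  unfolding variety_Aut_def
  by (rule subgroup.subgroup_is_group[OF subgroup_variety_automorphisms group_BijGroup])

end

theory Submission
  imports Defs
begin

text \<open>
  Write \<open>M = \<Prod>i=2..m. y\<^sub>i ^ k\<^sub>i\<close>, so that \<open>Y\<close> is \<open>y\<^sub>1 * M = P(z)\<close>. Two one-parameter families of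
  automorphisms are visible from the equation.

  The translations \<open>z \<mapsto> z + c * M\<close> form an action of the additive group: they fix
  \<open>y\<^sub>2, \<dots>, y\<^sub>m\<close>, and since \<open>P(z + c * M) - P(z)\<close> is divisible by \<open>M\<close> as a polynomial, the change
  on the right-hand side can be absorbed into \<open>y\<^sub>1\<close> (they are the flow of the locally nilpotent
  derivation \<open>M \<partial>/\<partial>z + P'(z) \<partial>/\<partial>y\<^sub>1\<close>). The scalings \<open>y\<^sub>2 \<mapsto> c * y\<^sub>2\<close>,
  \<open>y\<^sub>1 \<mapsto> c\<^sup>-\<^sup>k * y\<^sub>1\<close> with \<open>k = k\<^sub>2\<close> come from a one-dimensional torus; they fix \<open>z\<close> and multiply
  \<open>M\<close> by \<open>c ^ k\<^sub>2\<close>.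

  The torus therefore normalises the additive group without centralising it. The translation
  with parameter 1 and the scaling by 2 do not commute: applied to a point with \<open>M = 1\<close>, the two
  composites have last coordinates \<open>z + 1\<close> and \<open>z + 2 ^ k\<^sub>2\<close>, which differ in characteristic zero
  because \<open>k\<^sub>2 > 0\<close>. Lemmas \<open>translation_automorphism\<close> and \<open>scaling_automorphism\<close> carry the
  argument.
\<close>

text \<open>
  An explicit formula for the inverse map replaces the choice operator behind \<open>inv_into\<close>, whose
  regularity could not be read off.
\<close>

lemma restrict_in_variety_automorphisms:
  assumes f: "regular_map n Y n Y f" and g: "regular_map n Y n Y g"
    and gf: "\<And>y. y \<in> Y \<Longrightarrow> g (f y) = y" and fg: "\<And>y. y \<in> Y \<Longrightarrow> f (g y) = y"
  shows "restrict f Y \<in> variety_automorphisms n Y"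
proof -
  have fY: "\<And>y. y \<in> Y \<Longrightarrow> f y \<in> Y" and gY: "\<And>y. y \<in> Y \<Longrightarrow> g y \<in> Y"
    using f g by (auto simp: regular_map_def)
  have bij: "bij_betw (restrict f Y) Y Y"
    by (rule bij_betw_byWitness[where f' = g]) (auto simp: fY gY gf fg)
  have inv: "inv_into Y (restrict f Y) y = g y" if "y \<in> Y" for y
    using that bij gY fg by (intro inv_into_f_eq) (auto simp: bij_betw_def)
  have cong: "regular_map n Y n Y (restrict h Y)"
    if "regular_map n Y n Y h'" "\<And>y. y \<in> Y \<Longrightarrow> h y = h' y" for h h'
    using that by (auto simp: regular_map_def regular_function_def)
  show ?thesis
    using bij cong[OF f] cong[OF g inv] by (auto simp: variety_automorphisms_def Bij_def)
qed

lemma commute_on_variety: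
  assumes "comm_group (variety_Aut n Y)"
    and f: "restrict f Y \<in> variety_automorphisms n Y"
    and g: "restrict g Y \<in> variety_automorphisms n Y"
    and y: "y \<in> Y"
  shows "f (g y) = g (f y)"
proof -
  interpret comm_group "variety_Aut n Y" by fact
  have bij: "restrict f Y \<in> Bij Y" "restrict g Y \<in> Bij Y"
    using f g by (simp_all add: variety_automorphisms_def)
  have "compose Y (restrict f Y) (restrict g Y) = compose Y (restrict g Y) (restrict f Y)"
    using m_comm[of "restrict f Y" "restrict g Y"] f g bij
    by (simp add: variety_Aut_def BijGroup_def)
  then have "restrict f Y (restrict g Y y) = restrict g Y (restrict f Y y)"
    using y by (metis compose_eq)
  moreover have "f y \<in> Y" "g y \<in> Y"
    using bij[THEN Bij_imp_funcset] y by (auto simp: Pi_iff)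
  ultimately show ?thesis using y by simp
qed

lemma polynomial_functions_power:
  "p \<in> polynomial_functions n \<Longrightarrow> (\<lambda>x. p x ^ j) \<in> polynomial_functions n"
  by (induction j) (auto intro: polynomial_functions.const polynomial_functions.mult)

lemma polynomial_functions_prod:
  assumes "\<And>i. i \<in> I \<Longrightarrow> p i \<in> polynomial_functions n"
  shows "(\<lambda>x. \<Prod>i\<in>I. p i x) \<in> polynomial_functions n"
  using assms
  by (induction I rule: infinite_finite_induct)
    (auto intro: polynomial_functions.const polynomial_functions.mult)

lemma polynomial_functions_poly:
  "p \<in> polynomial_functions n \<Longrightarrow> (\<lambda>x. poly P (p x)) \<in> polynomial_functions n"
  by (induction P)
    (auto intro: polynomial_functions.const polynomial_functions.add polynomial_functions.mult)

text \<open>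
  The quotient \<open>(P(u) - P(v)) / (u - v)\<close> as a polynomial in \<open>u\<close> and \<open>v\<close>, meaningful also for
  \<open>u = v\<close>.
\<close>

definition divided_difference :: "'a::comm_ring_1 poly \<Rightarrow> 'a \<Rightarrow> 'a \<Rightarrow> 'a" where
  "divided_difference P u v = poly (synthetic_div P v) u"

lemma divided_difference_pCons [simp]:
  "divided_difference (pCons a P) u v = poly P v + u * divided_difference P u v"
  by (simp add: divided_difference_def)

lemma divided_difference_0 [simp]: "divided_difference 0 u v = 0"
  by (simp add: divided_difference_def)

lemma poly_diff_eq_mult_divided_difference:
  "poly P u - poly P v = (u - v) * divided_difference P u v"
proof (induction P)
  case (pCons a P)
  have "poly (pCons a P) u - poly (pCons a P) v
      = u * (poly P u - poly P v) + (u - v) * poly P v"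
    by (simp add: algebra_simps)
  then show ?case unfolding pCons.IH by (simp add: algebra_simps)
qed simp

lemma divided_difference_commute: "divided_difference P u v = divided_difference P v u"
proof (induction P)
  case (pCons a P)
  then show ?case
    using poly_diff_eq_mult_divided_difference[of P u v] by (simp add: algebra_simps)
qed simp

lemma polynomial_functions_divided_difference:
  assumes "p \<in> polynomial_functions n" "q \<in> polynomial_functions n"
  shows "(\<lambda>x. divided_difference P (p x) (q x)) \<in> polynomial_functions n"
  using assms
  by (induction P)
    (auto intro: polynomial_functions.const polynomial_functions.add polynomial_functions.mult
      polynomial_functions_poly)

definition tail_monomial :: "nat \<Rightarrow> (nat \<Rightarrow> nat) \<Rightarrow> (nat \<Rightarrow> 'a::comm_ring_1) \<Rightarrow> 'a" where
  "tail_monomial m k y = (\<Prod>i=2..m. y i ^ k i)"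

lemma Y_variety_iff:
  "y \<in> Y_variety m k P \<longleftrightarrow>
    y \<in> affine_space (m + 1) \<and> y 1 * tail_monomial m k y = poly P (y (m + 1))"
  by (simp add: Y_variety_def tail_monomial_def)

lemma fun_upd_in_affine_space:
  "y \<in> affine_space n \<Longrightarrow> i \<in> {1..n} \<Longrightarrow> y(i := c) \<in> affine_space n"
  by (auto simp: affine_space_def PiE_iff extensional_def)

lemma tail_monomial_cong:
  "(\<And>i. i \<in> {2..m} \<Longrightarrow> x i = y i) \<Longrightarrow> tail_monomial m k x = tail_monomial m k y"
  unfolding tail_monomial_def by (intro prod.cong) auto

lemma tail_monomial_in_polynomial_functions:
  "tail_monomial m k \<in> polynomial_functions (m + 1)"
  unfolding tail_monomial_def
  by (intro polynomial_functions_prod polynomial_functions_power polynomial_functions.coord) auto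

lemma regular_map_coordI:
  assumes "f \<in> X \<rightarrow> Y" "\<And>i. i \<in> {1..l} \<Longrightarrow> (\<lambda>x. f x i) \<in> polynomial_functions n"
  shows "regular_map n X l Y f"
  using assms by (auto simp: regular_map_def regular_function_def)

text \<open>
  The formula for \<open>y\<^sub>1\<close> is \<open>y\<^sub>1 + (P(z + c * M) - P(z)) / M\<close>, with the division carried out
  before \<open>M\<close> is allowed to vanish.
\<close>

definition translation ::
    "nat \<Rightarrow> (nat \<Rightarrow> nat) \<Rightarrow> 'a::comm_ring_1 poly \<Rightarrow> 'a \<Rightarrow> (nat \<Rightarrow> 'a) \<Rightarrow> (nat \<Rightarrow> 'a)" where
  "translation m k P c y =
    (let z = y (m + 1); w = z + c * tail_monomial m k y
     in y(1 := y 1 + c * divided_difference P w z, m + 1 := w))"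

lemma tail_monomial_translation [simp]:
  "tail_monomial m k (translation m k P c y) = tail_monomial m k y"
  by (rule tail_monomial_cong) (simp add: translation_def Let_def)

text \<open>
  The symmetry of the divided difference is what makes the change of \<open>y\<^sub>1\<close> cancel, also at points
  where \<open>M = 0\<close> and the equation of \<open>Y\<close> does not determine \<open>y\<^sub>1\<close>.
\<close>

lemma translation_uminus:
  assumes "m \<ge> 1"
  shows "translation m k P (- c) (translation m k P c y) = y"
proof -
  let ?x = "translation m k P c y" and ?M = "tail_monomial m k y"
  let ?z = "y (m + 1)" and ?w = "y (m + 1) + c * tail_monomial m k y"
  have w: "?x (m + 1) = ?w" and x1: "?x 1 = y 1 + c * divided_difference P ?w ?z"
    using assms by (simp_all add: translation_def Let_def)
  have other: "?x i = y i" if "i \<noteq> 1" "i \<noteq> m + 1" for i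
    using that by (simp add: translation_def Let_def)
  have "translation m k P (- c) ?x =
      ?x(1 := ?x 1 + (- c) * divided_difference P ?z ?w, m + 1 := ?z)"
    unfolding translation_def[of m k P "- c"] Let_def tail_monomial_translation w by simp
  also have "\<dots> = y"
    unfolding x1 divided_difference_commute[of P ?z ?w] by (auto simp: other fun_eq_iff)
  finally show ?thesis .
qed

lemma translation_regular:
  assumes "m \<ge> 1"
  shows "regular_map (m + 1) (Y_variety m k P) (m + 1) (Y_variety m k P) (translation m k P c)"
proof (rule regular_map_coordI)
  show "translation m k P c \<in> Y_variety m k P \<rightarrow> Y_variety m k P"
  proof
    fix y assume y: "y \<in> Y_variety m k P"
    let ?M = "tail_monomial m k y" and ?z = "y (m + 1)"
    let ?w = "?z + c * ?M"
    have "(y 1 + c * divided_difference P ?w ?z) * ?M = poly P ?z + (poly P ?w - poly P ?z)"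
      using y unfolding poly_diff_eq_mult_divided_difference
      by (simp add: Y_variety_iff algebra_simps)
    moreover have "translation m k P c y \<in> affine_space (m + 1)"
      using y by (auto simp: translation_def Let_def Y_variety_iff intro!: fun_upd_in_affine_space)
    ultimately show "translation m k P c y \<in> Y_variety m k P"
      using assms unfolding Y_variety_iff tail_monomial_translation
      by (simp add: translation_def Let_def)
  qed
next
  fix i assume i: "i \<in> {1..m + 1}"
  have coord: "(\<lambda>y. y j) \<in> polynomial_functions (m + 1)" if "j \<in> {1..m + 1}" for j
    using that by (rule polynomial_functions.coord)
  have w: "(\<lambda>y. y (m + 1) + c * tail_monomial m k y) \<in> polynomial_functions (m + 1)"
    by (intro polynomial_functions.add polynomial_functions.mult polynomial_functions.const
        tail_monomial_in_polynomial_functions coord) simp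
  have "(\<lambda>y. y 1 + c * divided_difference P (y (m + 1) + c * tail_monomial m k y) (y (m + 1)))
      \<in> polynomial_functions (m + 1)"
    by (intro polynomial_functions.add polynomial_functions.mult polynomial_functions.const
        polynomial_functions_divided_difference w coord) simp_all
  then show "(\<lambda>y. translation m k P c y i) \<in> polynomial_functions (m + 1)"
    using w coord[OF i] assms
    by (cases "i = 1"; cases "i = m + 1") (simp_all add: translation_def Let_def)
qed

lemma translation_automorphism:
  assumes "m \<ge> 1"
  shows "restrict (translation m k P c) (Y_variety m k P)
    \<in> variety_automorphisms (m + 1) (Y_variety m k P)"
  using translation_uminus[OF assms, of k P c] translation_uminus[OF assms, of k P "- c"]
  by (intro restrict_in_variety_automorphisms[where g = "translation m k P (- c)"]
      translation_regular assms) simp_all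

definition scaling :: "(nat \<Rightarrow> nat) \<Rightarrow> 'a::field \<Rightarrow> (nat \<Rightarrow> 'a) \<Rightarrow> (nat \<Rightarrow> 'a)" where
  "scaling k c y = y(1 := inverse c ^ k 2 * y 1, 2 := c * y 2)"

lemma tail_monomial_scaling:
  assumes "m \<ge> 2"
  shows "tail_monomial m k (scaling k c y) = c ^ k 2 * tail_monomial m k y"
proof -
  have "tail_monomial m k x = x 2 ^ k 2 * (\<Prod>i=3..m. x i ^ k i)" for x :: "nat \<Rightarrow> 'a"
    using assms by (simp add: tail_monomial_def prod.atLeast_Suc_atMost numeral_3_eq_3)
  moreover have "(\<Prod>i=3..m. scaling k c y i ^ k i) = (\<Prod>i=3..m. y i ^ k i)"
    by (intro prod.cong) (auto simp: scaling_def)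
  ultimately show ?thesis by (simp add: scaling_def power_mult_distrib)
qed

lemma scaling_inverse:
  assumes "c \<noteq> 0"
  shows "scaling k (inverse c) (scaling k c y) = y"
  using assms by (auto simp: scaling_def fun_eq_iff power_inverse)

lemma scaling_regular:
  assumes "m \<ge> 2" "c \<noteq> 0"
  shows "regular_map (m + 1) (Y_variety m k P) (m + 1) (Y_variety m k P) (scaling k c)"
proof (rule regular_map_coordI)
  show "scaling k c \<in> Y_variety m k P \<rightarrow> Y_variety m k P"
  proof
    fix y assume y: "y \<in> Y_variety m k P"
    have "scaling k c y \<in> affine_space (m + 1)"
      using y assms by (auto simp: scaling_def Y_variety_iff intro!: fun_upd_in_affine_space)
    moreover have "inverse c ^ k 2 * y 1 * (c ^ k 2 * tail_monomial m k y) = poly P (y (m + 1))"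
      using y assms by (simp add: Y_variety_iff power_inverse field_simps)
    moreover have "scaling k c y 1 = inverse c ^ k 2 * y 1" "scaling k c y (m + 1) = y (m + 1)"
      using assms by (simp_all add: scaling_def)
    ultimately show "scaling k c y \<in> Y_variety m k P"
      by (simp add: Y_variety_iff tail_monomial_scaling[OF assms(1)])
  qed
next
  fix i assume i: "i \<in> {1..m + 1}"
  have "(\<lambda>y. a * y i) \<in> polynomial_functions (m + 1)" for a :: 'a
    by (intro polynomial_functions.mult polynomial_functions.const polynomial_functions.coord i)
  from this[of "inverse c ^ k 2"] this[of c] this[of 1]
  show "(\<lambda>y. scaling k c y i) \<in> polynomial_functions (m + 1)"
    by (cases "i = 1"; cases "i = 2") (simp_all add: scaling_def)
qed

lemma scaling_automorphism:
  assumes "m \<ge> 2" "c \<noteq> 0"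
  shows "restrict (scaling k c) (Y_variety m k P)
    \<in> variety_automorphisms (m + 1) (Y_variety m k P)"
  using scaling_inverse[OF assms(2), of k] scaling_inverse[of "inverse c" k] assms
  by (intro restrict_in_variety_automorphisms[where g = "scaling k (inverse c)"]
      scaling_regular) simp_all

theorem corollary6p6:
  fixes P :: "'a::{alg_closed_field, field_char_0} poly"
    and m :: nat
    and k :: "nat \<Rightarrow> nat"
  assumes "m \<ge> 2"
    and "\<And>i. i \<in> {2..m} \<Longrightarrow> k i \<ge> 2"
    and "degree P \<ge> 2"
  shows "\<not> comm_group (variety_Aut (m + 1) (Y_variety m k P))"
proof
  assume comm: "comm_group (variety_Aut (m + 1) (Y_variety m k P))"
  \<comment> \<open>The point \<open>y\<^sub>2 = \<dots> = y\<^sub>m = 1\<close>, \<open>z = 0\<close>, where \<open>M = 1\<close> and hence \<open>y\<^sub>1 = P(0)\<close>.\<close>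
  define y :: "nat \<Rightarrow> 'a" where
    "y = (\<lambda>i\<in>{1..m + 1}. if i = 1 then poly P 0 else if i = m + 1 then 0 else 1)"
  have M: "tail_monomial m k y = 1"
    by (simp add: tail_monomial_def y_def)
  have y: "y \<in> Y_variety m k P"
    unfolding Y_variety_iff M using assms(1) by (simp add: affine_space_def y_def)
  have "translation m k P 1 (scaling k 2 y) = scaling k 2 (translation m k P 1 y)"
    by (rule commute_on_variety[OF comm translation_automorphism scaling_automorphism y])
      (use assms(1) in simp_all)
  then have "translation m k P 1 (scaling k 2 y) (m + 1)
      = scaling k 2 (translation m k P 1 y) (m + 1)"
    by simp
  then have "(2::'a) ^ k 2 = 1"
    using assms(1)
    by (simp add: translation_def Let_def tail_monomial_scaling M) (simp add: scaling_def M)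
  then have "(2::nat) ^ k 2 = 1"
    by (metis of_nat_1 of_nat_eq_iff of_nat_numeral of_nat_power)
  then show False using assms(1) assms(2)[of 2] by simp
qed

end
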